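(* Let $\Phi$ be a non-degenerate Musielak--Orlicz function. Then $h_\Phi\cong\ell_\Phi$ if and only if the modular $\widetilde\Phi$ has a strong minimum at $0$ (on $\ell_\Phi$).
   Context: An Orlicz function is an even, continuous, convex function $M:\mathbb{R}\to\mathbb{R}$, nondecreasing on $[0,\infty)$ with $M(0)=0$; it is non-degenerate if $M(t)>0$ for all $t>0$. A Musielak--Orlicz function is a sequence $\Phi=\{\Phi_i\}_{i=1}^\infty$ of Orlicz functions; it is non-degenerate if every $\Phi_i$ is. The modular is $\widetilde\Phi(x)=\sum_{i=1}^\infty\Phi_i(x_i)\in[0,+\infty]$. $\ell_\Phi$ is the space of real sequences $x$ with $\widetilde\Phi(\lambda x)<\infty$ for some $\lambda>0$, with the Luxemburg norm $\|x\|_\Phi=\inf\{r>0:\widetilde\Phi(x/r)\le 1\}$. $h_\Phi$ is the closed linear subspace of $\ell_\Phi$ generated by all $x\in\ell_\Phi$ with $\widetilde\Phi(\lambda x)<\infty$ for every $\lambda>0$. $h_\Phi\cong\ell_\Phi$ means that the two spaces coincide. A function $g$ has a strong minimum at $z$ if $g$ attains its minimum at $z$ and every minimizing sequence of $g$ converges in norm to $z$. *)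

theory Defs
  imports "HOL-Analysis.Analysis" "HOL-Library.Function_Algebras"
begin

definition orlicz :: "(real \<Rightarrow> real) \<Rightarrow> bool" where
  "orlicz M \<longleftrightarrow>
     (\<forall>t. M (- t) = M t) \<and> continuous_on UNIV M \<and> convex_on UNIV M \<and>
     mono_on {0..} M \<and> M 0 = 0"

definition nondegenerate :: "(real \<Rightarrow> real) \<Rightarrow> bool" where
  "nondegenerate M \<longleftrightarrow> (\<forall>t>0. M t > 0)"

definition musielak_orlicz :: "(nat \<Rightarrow> real \<Rightarrow> real) \<Rightarrow> bool" where
  "musielak_orlicz \<Phi> \<longleftrightarrow> (\<forall>i. orlicz (\<Phi> i))"

definition nondegenerate_seq :: "(nat \<Rightarrow> real \<Rightarrow> real) \<Rightarrow> bool" where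
  "nondegenerate_seq \<Phi> \<longleftrightarrow> (\<forall>i. nondegenerate (\<Phi> i))"

text \<open>Orlicz functions are nonnegative (lemma \<open>orlicz_nonneg\<close> below), so \<open>ennreal\<close> truncates nothing.\<close>

definition modular :: "(nat \<Rightarrow> real \<Rightarrow> real) \<Rightarrow> (nat \<Rightarrow> real) \<Rightarrow> ennreal" where
  "modular \<Phi> x = (\<Sum>i. ennreal (\<Phi> i (x i)))"

definition seq_scale :: "real \<Rightarrow> (nat \<Rightarrow> real) \<Rightarrow> nat \<Rightarrow> real" where
  "seq_scale c x = (\<lambda>i. c * x i)"

text \<open>Addition and subtraction of sequences are the pointwise operations on functions.\<close>

interpretation seqs: vector_space seq_scale
  by unfold_locales (auto simp: seq_scale_def fun_eq_iff algebra_simps)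

definition ell :: "(nat \<Rightarrow> real \<Rightarrow> real) \<Rightarrow> (nat \<Rightarrow> real) set" where
  "ell \<Phi> = {x. \<exists>c>0. modular \<Phi> (seq_scale c x) < \<infinity>}"

definition lux_norm :: "(nat \<Rightarrow> real \<Rightarrow> real) \<Rightarrow> (nat \<Rightarrow> real) \<Rightarrow> real" where
  "lux_norm \<Phi> x = Inf {r. r > 0 \<and> modular \<Phi> (seq_scale (1 / r) x) \<le> 1}"

definition lux_dist :: "(nat \<Rightarrow> real \<Rightarrow> real) \<Rightarrow> (nat \<Rightarrow> real) \<Rightarrow> (nat \<Rightarrow> real) \<Rightarrow> real" where
  "lux_dist \<Phi> x y = (if x \<in> ell \<Phi> \<and> y \<in> ell \<Phi> then lux_norm \<Phi> (x - y) else 0)"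

text \<open>
  The value 0 outside \<open>ell \<Phi>\<close> is immaterial: the locale \<open>Metric_space\<close> asks for nonnegativity and
  symmetry on the whole type, whereas its topology depends only on the carrier.
  \<open>Metric_space.mtopology\<close> is meaningful only for actual metrics; for non-degenerate
  Musielak--Orlicz functions this is lemma \<open>Metric_space_ell\<close> below.
\<close>

definition ell_topology :: "(nat \<Rightarrow> real \<Rightarrow> real) \<Rightarrow> (nat \<Rightarrow> real) topology" where
  "ell_topology \<Phi> = Metric_space.mtopology (ell \<Phi>) (lux_dist \<Phi>)"

definition h_space :: "(nat \<Rightarrow> real \<Rightarrow> real) \<Rightarrow> (nat \<Rightarrow> real) set" where
  "h_space \<Phi> = ell_topology \<Phi> closure_of
     seqs.span {x \<in> ell \<Phi>. \<forall>c>0. modular \<Phi> (seq_scale c x) < \<infinity>}"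

definition strong_minimum ::
  "'a topology \<Rightarrow> ('a \<Rightarrow> 'b::{complete_linorder, order_topology}) \<Rightarrow> 'a \<Rightarrow> bool" where
  "strong_minimum X g z \<longleftrightarrow>
     z \<in> topspace X \<and> (\<forall>x\<in>topspace X. g z \<le> g x) \<and>
     (\<forall>u. (\<forall>n::nat. u n \<in> topspace X) \<and>
          (\<lambda>n. g (u n)) \<longlonglongrightarrow> (INF x\<in>topspace X. g x)
          \<longrightarrow> limitin X u z sequentially)"

lemma orlicz_nonneg:
  assumes "orlicz M"
  shows "0 \<le> M t"
proof -
  have *: "0 \<le> M s" if "s \<ge> 0" for s
    using assms that mono_onD[of "{0..}" M 0 s] by (auto simp: orlicz_def)
  show ?thesis
    using *[of t] *[of "- t"] assms by (cases "t \<ge> 0") (auto simp: orlicz_def)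
qed

lemma orlicz_convex:
  assumes "orlicz M" "0 \<le> a" "0 \<le> b" "a + b = 1"
  shows "M (a * s + b * t) \<le> a * M s + b * M t"
  using assms unfolding orlicz_def convex_on_def by auto

lemma orlicz_scale:
  assumes "orlicz M" "0 \<le> a" "a \<le> 1"
  shows "M (a * s) \<le> a * M s"
  using orlicz_convex[OF assms(1,2), of "1 - a" s 0] assms by (simp add: orlicz_def)

lemma modular_convex:
  assumes "musielak_orlicz \<Phi>" "0 \<le> a" "0 \<le> b" "a + b = 1"
  shows "modular \<Phi> (seq_scale a x + seq_scale b y)
           \<le> ennreal a * modular \<Phi> x + ennreal b * modular \<Phi> y"
proof -
  have nn: "0 \<le> \<Phi> i t" for i t
    using assms(1) orlicz_nonneg by (auto simp: musielak_orlicz_def)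
  have "modular \<Phi> (seq_scale a x + seq_scale b y)
      \<le> (\<Sum>i. ennreal a * ennreal (\<Phi> i (x i)) + ennreal b * ennreal (\<Phi> i (y i)))"
    unfolding modular_def
  proof (rule suminf_le)
    fix i
    have "\<Phi> i (a * x i + b * y i) \<le> a * \<Phi> i (x i) + b * \<Phi> i (y i)"
      using assms orlicz_convex by (auto simp: musielak_orlicz_def)
    then show "ennreal (\<Phi> i ((seq_scale a x + seq_scale b y) i))
      \<le> ennreal a * ennreal (\<Phi> i (x i)) + ennreal b * ennreal (\<Phi> i (y i))"
      using assms nn
      by (simp add: seq_scale_def ennreal_mult[symmetric] ennreal_plus[symmetric] ennreal_leI
          del: ennreal_plus)
  qed auto
  also have "\<dots> = ennreal a * modular \<Phi> x + ennreal b * modular \<Phi> y"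
    by (simp add: modular_def suminf_add[symmetric])
  finally show ?thesis .
qed

lemma modular_zero:
  assumes "musielak_orlicz \<Phi>"
  shows "modular \<Phi> 0 = 0"
  using assms by (simp add: modular_def musielak_orlicz_def orlicz_def)

lemma modular_scale:
  assumes "musielak_orlicz \<Phi>" "0 \<le> a" "a \<le> 1"
  shows "modular \<Phi> (seq_scale a x) \<le> ennreal a * modular \<Phi> x"
  using modular_convex[OF assms(1,2), of "1 - a" x 0] assms modular_zero[OF assms(1)]
  by (simp add: seqs.scale_zero_right)

lemma modular_minus:
  assumes "musielak_orlicz \<Phi>"
  shows "modular \<Phi> (- x) = modular \<Phi> x"
  using assms by (simp add: modular_def musielak_orlicz_def orlicz_def)

lemma modular_scale_mono:
  assumes "musielak_orlicz \<Phi>" "0 \<le> a" "a \<le> b"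
  shows "modular \<Phi> (seq_scale a x) \<le> modular \<Phi> (seq_scale b x)"
proof (cases "b = 0")
  case False
  then have "modular \<Phi> (seq_scale (a / b) (seq_scale b x))
      \<le> ennreal (a / b) * modular \<Phi> (seq_scale b x)"
    using assms by (intro modular_scale) auto
  also have "\<dots> \<le> 1 * modular \<Phi> (seq_scale b x)"
    using assms False by (intro mult_right_mono) (auto simp: ennreal_le_1)
  finally show ?thesis using False by simp
qed (use assms in auto)

lemma lux_set_nonempty:
  assumes "musielak_orlicz \<Phi>" "x \<in> ell \<Phi>"
  shows "\<exists>r>0. modular \<Phi> (seq_scale (1 / r) x) \<le> 1"
proof -
  obtain c where c: "c > 0" "modular \<Phi> (seq_scale c x) < \<infinity>"
    using assms by (auto simp: ell_def)
  define K where "K = max 1 (enn2real (modular \<Phi> (seq_scale c x)))"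
  have K: "K \<ge> 1" "modular \<Phi> (seq_scale c x) \<le> ennreal K"
    using c by (auto simp: K_def ennreal_enn2real_if
        intro: order_trans[OF _ ennreal_leI[OF max.cobounded2]])
  have "modular \<Phi> (seq_scale (1 / K) (seq_scale c x))
      \<le> ennreal (1 / K) * modular \<Phi> (seq_scale c x)"
    using K assms(1) by (intro modular_scale) auto
  also have "\<dots> \<le> ennreal (1 / K) * ennreal K"
    using K by (intro mult_left_mono) auto
  also have "\<dots> = 1" using K by (simp add: ennreal_mult[symmetric])
  finally show ?thesis using c K by (intro exI[of _ "K / c"]) auto
qed

lemma bdd_below_lux: "bdd_below {r::real. r > 0 \<and> P r}"
  by (rule bdd_belowI[of _ 0]) auto

lemma lux_norm_nonneg:
  assumes "musielak_orlicz \<Phi>" "x \<in> ell \<Phi>"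
  shows "0 \<le> lux_norm \<Phi> x"
  unfolding lux_norm_def using lux_set_nonempty[OF assms] by (intro cInf_greatest) auto

lemma lux_norm_le:
  assumes "r > 0" "modular \<Phi> (seq_scale (1 / r) x) \<le> 1"
  shows "lux_norm \<Phi> x \<le> r"
  unfolding lux_norm_def using assms by (intro cInf_lower bdd_below_lux) auto

lemma modular_le_1:
  assumes "musielak_orlicz \<Phi>" "x \<in> ell \<Phi>" "lux_norm \<Phi> x < r"
  shows "modular \<Phi> (seq_scale (1 / r) x) \<le> 1"
proof -
  have "\<exists>s\<in>{s. s > 0 \<and> modular \<Phi> (seq_scale (1 / s) x) \<le> 1}. s < r"
    using lux_set_nonempty[OF assms(1,2)] assms(3) unfolding lux_norm_def
    by (subst (asm) cInf_less_iff) (auto intro: bdd_below_lux)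
  then obtain s where s: "0 < s" "s < r" "modular \<Phi> (seq_scale (1 / s) x) \<le> 1" by auto
  have "modular \<Phi> (seq_scale (1 / r) x) \<le> modular \<Phi> (seq_scale (1 / s) x)"
    using s assms(1) by (intro modular_scale_mono) (auto simp: field_simps)
  then show ?thesis using s by auto
qed

lemma lux_norm_add:
  assumes "musielak_orlicz \<Phi>" "x \<in> ell \<Phi>" "y \<in> ell \<Phi>"
  shows "lux_norm \<Phi> (x + y) \<le> lux_norm \<Phi> x + lux_norm \<Phi> y"
proof (rule field_le_epsilon)
  fix e :: real assume e: "e > 0"
  define a where "a = lux_norm \<Phi> x + e / 2"
  define b where "b = lux_norm \<Phi> y + e / 2"
  have ab: "a > 0" "b > 0" "lux_norm \<Phi> x < a" "lux_norm \<Phi> y < b"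
    using e lux_norm_nonneg[OF assms(1,2)] lux_norm_nonneg[OF assms(1,3)]
    by (auto simp: a_def b_def)
  have eq: "seq_scale (1 / (a + b)) (x + y)
      = seq_scale (a / (a + b)) (seq_scale (1 / a) x) + seq_scale (b / (a + b)) (seq_scale (1 / b) y)"
    using ab by (simp add: seqs.scale_right_distrib)
  have "modular \<Phi> (seq_scale (1 / (a + b)) (x + y))
      \<le> ennreal (a / (a + b)) * modular \<Phi> (seq_scale (1 / a) x)
        + ennreal (b / (a + b)) * modular \<Phi> (seq_scale (1 / b) y)"
    unfolding eq using ab assms(1)
    by (intro modular_convex) (auto simp: add_divide_distrib[symmetric])
  also have "\<dots> \<le> ennreal (a / (a + b)) * 1 + ennreal (b / (a + b)) * 1"
    using ab assms by (intro add_mono mult_left_mono modular_le_1) auto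
  also have "\<dots> = 1"
    using ab by (simp add: ennreal_plus[symmetric] add_divide_distrib[symmetric] del: ennreal_plus)
  finally have "lux_norm \<Phi> (x + y) \<le> a + b"
    using ab by (intro lux_norm_le) auto
  then show "lux_norm \<Phi> (x + y) \<le> lux_norm \<Phi> x + lux_norm \<Phi> y + e"
    by (simp add: a_def b_def)
qed

lemma subspace_ell:
  assumes "musielak_orlicz \<Phi>"
  shows "seqs.subspace (ell \<Phi>)"
proof (rule seqs.subspaceI)
  show "0 \<in> ell \<Phi>"
    using modular_zero[OF assms] by (auto simp: ell_def intro!: exI[of _ 1])
next
  fix x y assume "x \<in> ell \<Phi>" "y \<in> ell \<Phi>"
  then obtain c d where cd: "c > 0" "d > 0" "modular \<Phi> (seq_scale c x) < \<infinity>"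
      "modular \<Phi> (seq_scale d y) < \<infinity>"
    by (auto simp: ell_def)
  define m where "m = min c d"
  have m: "m > 0" "modular \<Phi> (seq_scale m x) < \<infinity>" "modular \<Phi> (seq_scale m y) < \<infinity>"
    using cd modular_scale_mono[OF assms, of m c x] modular_scale_mono[OF assms, of m d y]
    by (auto simp: m_def intro: le_less_trans)
  have eq: "seq_scale (m / 2) (x + y)
      = seq_scale (1 / 2) (seq_scale m x) + seq_scale (1 / 2) (seq_scale m y)"
    by (simp add: seqs.scale_right_distrib)
  have "modular \<Phi> (seq_scale (m / 2) (x + y))
      \<le> ennreal (1 / 2) * modular \<Phi> (seq_scale m x) + ennreal (1 / 2) * modular \<Phi> (seq_scale m y)"
    unfolding eq using assms by (intro modular_convex) auto
  also have "\<dots> < \<infinity>"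
    using m ennreal_less_top[of "1 / 2"]
    by (simp add: ennreal_mult_less_top del: ennreal_half)
  finally show "x + y \<in> ell \<Phi>"
    using m by (auto simp: ell_def intro!: exI[of _ "m / 2"])
next
  fix a x assume "x \<in> ell \<Phi>"
  then obtain c where c: "c > 0" "modular \<Phi> (seq_scale c x) < \<infinity>"
    by (auto simp: ell_def)
  have "modular \<Phi> (seq_scale (c / (\<bar>a\<bar> + 1)) (seq_scale a x)) < \<infinity>"
  proof -
    have "modular \<Phi> (seq_scale (c * \<bar>a\<bar> / (\<bar>a\<bar> + 1)) x) \<le> modular \<Phi> (seq_scale c x)"
      using c assms by (intro modular_scale_mono) (auto simp: field_simps)
    moreover have "modular \<Phi> (seq_scale (c * \<bar>a\<bar> / (\<bar>a\<bar> + 1)) x)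
        = modular \<Phi> (seq_scale (c / (\<bar>a\<bar> + 1)) (seq_scale a x))"
    proof (cases "a \<ge> 0")
      case False
      then have "seq_scale (c * \<bar>a\<bar> / (\<bar>a\<bar> + 1)) x
          = - seq_scale (c / (\<bar>a\<bar> + 1)) (seq_scale a x)"
        by (simp add: seq_scale_def fun_eq_iff)
      then show ?thesis using modular_minus[OF assms] by simp
    qed simp
    ultimately show ?thesis using c by auto
  qed
  then show "seq_scale a x \<in> ell \<Phi>"
    using c by (auto simp: ell_def intro!: exI[of _ "c / (\<bar>a\<bar> + 1)"])
qed

lemma lux_norm_zero_iff:
  assumes "musielak_orlicz \<Phi>" "nondegenerate_seq \<Phi>" "x \<in> ell \<Phi>"
  shows "lux_norm \<Phi> x = 0 \<longleftrightarrow> x = 0"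
proof
  assume 0: "lux_norm \<Phi> x = 0"
  show "x = 0"
  proof (rule ccontr)
    assume "x \<noteq> 0"
    then obtain i where i: "x i \<noteq> 0" by (auto simp: fun_eq_iff)
    have o: "orlicz (\<Phi> i)" using assms by (auto simp: musielak_orlicz_def)
    define p where "p = \<Phi> i (x i)"
    have "p > 0"
      using i o assms(2) unfolding p_def nondegenerate_seq_def nondegenerate_def orlicz_def
      by (metis linorder_neqE_linordered_idom neg_0_less_iff_less)
    define r where "r = min 1 (p / 2)"
    have r: "r > 0" "r \<le> 1" "r \<le> p / 2" using \<open>p > 0\<close> by (auto simp: r_def)
    have "ennreal (\<Phi> i (1 / r * x i)) \<le> (\<Sum>i. ennreal (\<Phi> i (1 / r * x i)))"
      using sum_le_suminf[of "\<lambda>i. ennreal (\<Phi> i (1 / r * x i))" "{i}"] by simp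
    also have "\<dots> \<le> 1"
      using modular_le_1[OF assms(1,3), of r] 0 r by (simp add: modular_def seq_scale_def)
    finally have le: "\<Phi> i (1 / r * x i) \<le> 1" by (simp add: ennreal_le_1)
    have "p \<le> r * \<Phi> i (1 / r * x i)"
      using orlicz_scale[OF o, of r "1 / r * x i"] r by (simp add: p_def)
    also have "\<dots> \<le> r * 1" using le r by (intro mult_left_mono) auto
    finally show False using r \<open>p > 0\<close> by simp
  qed
next
  assume "x = 0"
  have "lux_norm \<Phi> x \<le> 0 + e" if "e > 0" for e
    using that modular_zero[OF assms(1)] \<open>x = 0\<close> lux_norm_le[of e \<Phi> x]
    by (simp add: seqs.scale_zero_right)
  then have "lux_norm \<Phi> x \<le> 0" by (rule field_le_epsilon)
  then show "lux_norm \<Phi> x = 0" using lux_norm_nonneg[OF assms(1,3)] by simp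
qed

lemma lux_norm_minus:
  assumes "musielak_orlicz \<Phi>"
  shows "lux_norm \<Phi> (- x) = lux_norm \<Phi> x"
  using modular_minus[OF assms] by (simp add: lux_norm_def seqs.scale_minus_right)

lemma Metric_space_ell:
  assumes "musielak_orlicz \<Phi>" "nondegenerate_seq \<Phi>"
  shows "Metric_space (ell \<Phi>) (lux_dist \<Phi>)"
proof -
  have diff: "x - y \<in> ell \<Phi>" if "x \<in> ell \<Phi>" "y \<in> ell \<Phi>" for x y
    using subspace_ell[OF assms(1)] that by (rule seqs.subspace_diff)
  show ?thesis
  proof
    show "0 \<le> lux_dist \<Phi> x y" for x y
      using lux_norm_nonneg[OF assms(1) diff] by (simp add: lux_dist_def)
    show "lux_dist \<Phi> x y = lux_dist \<Phi> y x" for x y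
      using lux_norm_minus[OF assms(1), of "x - y"] by (simp add: lux_dist_def)
    show "lux_dist \<Phi> x y = 0 \<longleftrightarrow> x = y" if "x \<in> ell \<Phi>" "y \<in> ell \<Phi>" for x y
      using lux_norm_zero_iff[OF assms diff[OF that]] that by (simp add: lux_dist_def)
    show "lux_dist \<Phi> x z \<le> lux_dist \<Phi> x y + lux_dist \<Phi> y z"
      if "x \<in> ell \<Phi>" "y \<in> ell \<Phi>" "z \<in> ell \<Phi>" for x y z
      using lux_norm_add[OF assms(1) diff[OF that(1,2)] diff[OF that(2,3)]] that
      by (simp add: lux_dist_def)
  qed
qed

end

theory Submission
  imports Defs
begin

text \<open>
  The sequences all of whose multiples have finite modular form a closed subspace, so the heart is
  everything iff finite modular is inherited by all multiples. In that case, if the modulars of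
  \<open>v n\<close> tend to 0 fast enough to be summable, the pointwise supremum of the \<open>\<bar>v n\<bar>\<close> has finite
  modular; its multiples then dominate those of \<open>v n\<close>, and dominated convergence for series forces
  norm convergence. Conversely, the tails of a sequence of finite modular are a minimizing sequence
  of the modular, so a strong minimum makes finitely supported sequences dense.
\<close>

section \<open>Single Orlicz functions: monotonicity in the absolute value, null sequences\<close>

lemma orlicz_abs: "orlicz M \<Longrightarrow> M \<bar>t\<bar> = M t"
  by (auto simp: orlicz_def abs_if)

lemma orlicz_mono_abs:
  assumes "orlicz M" "\<bar>s\<bar> \<le> \<bar>t\<bar>"
  shows "M s \<le> M t"
proof -
  have "M \<bar>s\<bar> \<le> M \<bar>t\<bar>"
    using assms mono_onD[of "{0..}" M "\<bar>s\<bar>" "\<bar>t\<bar>"] by (auto simp: orlicz_def)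
  then show ?thesis using assms by (simp add: orlicz_abs)
qed

lemma orlicz_tendsto_zero:
  assumes "orlicz M" "v \<longlonglongrightarrow> 0"
  shows "(\<lambda>n. M (v n)) \<longlonglongrightarrow> 0"
proof -
  have "isCont M 0" "M 0 = 0"
    using assms(1) by (auto simp: orlicz_def continuous_on_eq_continuous_at)
  then show ?thesis using isCont_tendsto_compose[OF _ assms(2), of M] by simp
qed

text \<open>Nondegeneracy makes \<open>M e\<close> a positive threshold, and monotonicity in the
  absolute value turns \<open>M (v n) < M e\<close> into \<open>\<bar>v n\<bar> < e\<close>.\<close>

lemma nondegenerate_tendsto_zero:
  assumes "orlicz M" "nondegenerate M" "(\<lambda>n. M (v n)) \<longlonglongrightarrow> 0"
  shows "v \<longlonglongrightarrow> 0"
proof (rule LIMSEQ_I)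
  fix e :: real assume "e > 0"
  then have "0 < M e" using assms(2) by (simp add: nondegenerate_def)
  with assms(3) have "eventually (\<lambda>n. M (v n) < M e) sequentially"
    by (rule order_tendstoD)
  then obtain N where "M (v n) < M e" if "n \<ge> N" for n
    by (auto simp: eventually_sequentially)
  then have "norm (v n - 0) < e" if "n \<ge> N" for n
    using that orlicz_mono_abs[OF assms(1), of e "v n"] \<open>e > 0\<close> by force
  then show "\<exists>N. \<forall>n\<ge>N. norm (v n - 0) < e" by blast
qed

section \<open>Limit theorems for the modular, read as an integral over counting measure\<close>

lemma modular_eq_nn_integral:
  "modular \<Phi> x = (\<integral>\<^sup>+ i. ennreal (\<Phi> i (x i)) \<partial>count_space UNIV)"
  by (simp add: modular_def nn_integral_count_space_nat)

lemma le_modular: "ennreal (\<Phi> i (x i)) \<le> modular \<Phi> x"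
  unfolding modular_def using sum_le_suminf[of "\<lambda>i. ennreal (\<Phi> i (x i))" "{i}"] by simp

text \<open>Dominated convergence for the counting measure: the terms \<open>\<Phi> i (w i)\<close>
  form the integrable bound, and continuity of each \<open>\<Phi> i\<close> at 0 gives the pointwise
  limits.\<close>

lemma modular_dominated_tendsto_zero:
  assumes \<Phi>: "musielak_orlicz \<Phi>"
    and w: "modular \<Phi> w < \<infinity>"
    and le: "\<And>n i. \<bar>v n i\<bar> \<le> \<bar>w i\<bar>"
    and lim: "\<And>i. (\<lambda>n. v n i) \<longlonglongrightarrow> 0"
  shows "(\<lambda>n. modular \<Phi> (v n)) \<longlonglongrightarrow> 0"
proof -
  have o: "orlicz (\<Phi> i)" for i using \<Phi> by (simp add: musielak_orlicz_def)
  have "(\<lambda>n. \<integral>\<^sup>+ i. ennreal (\<Phi> i (v n i)) \<partial>count_space UNIV)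
      \<longlonglongrightarrow> (\<integral>\<^sup>+ (i::nat). 0 \<partial>count_space UNIV)"
  proof (rule nn_integral_dominated_convergence[where w = "\<lambda>i. ennreal (\<Phi> i (w i))"])
    show "AE i in count_space UNIV. (\<lambda>n. ennreal (\<Phi> i (v n i))) \<longlonglongrightarrow> 0"
      using tendsto_ennrealI[OF orlicz_tendsto_zero[OF o lim]] by simp
  qed (use w in \<open>auto simp: modular_eq_nn_integral intro!: ennreal_leI orlicz_mono_abs[OF o] le\<close>)
  then show ?thesis by (simp add: modular_eq_nn_integral)
qed

text \<open>The modular bounds each of its terms, so every \<open>\<Phi> i (v n i)\<close> tends to
  0 and nondegeneracy passes this on to the coordinate.\<close>

lemma modular_tendsto_zero_pointwise:
  assumes "musielak_orlicz \<Phi>" "nondegenerate_seq \<Phi>" "(\<lambda>n. modular \<Phi> (v n)) \<longlonglongrightarrow> 0"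
  shows "(\<lambda>n. v n i) \<longlonglongrightarrow> 0"
proof -
  have o: "orlicz (\<Phi> i)" "nondegenerate (\<Phi> i)"
    using assms by (auto simp: musielak_orlicz_def nondegenerate_seq_def)
  have "(\<lambda>n. ennreal (\<Phi> i (v n i))) \<longlonglongrightarrow> ennreal 0"
    by (rule tendsto_sandwich[OF _ _ tendsto_const[of "ennreal 0"]])
      (use assms(3) in \<open>auto simp: le_modular\<close>)
  then have "(\<lambda>n. \<Phi> i (v n i)) \<longlonglongrightarrow> 0"
    using o by (subst (asm) tendsto_ennreal_iff) (auto simp: orlicz_nonneg)
  then show ?thesis by (rule nondegenerate_tendsto_zero[OF o])
qed

text \<open>In a fixed coordinate, each single value of \<open>\<Phi> i\<close> is at most the sum
  over \<open>n\<close>. Continuity makes the corresponding sublevel set closed, so it also contains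
  the supremum. Interchanging the two sums finishes the argument.\<close>

lemma modular_Sup_abs_le:
  assumes \<Phi>: "musielak_orlicz \<Phi>" and bdd: "\<And>i. bdd_above (range (\<lambda>n. \<bar>v n i\<bar>))"
  shows "modular \<Phi> (\<lambda>i. SUP n. \<bar>v n i\<bar>) \<le> (\<Sum>n. modular \<Phi> (v n))"
proof -
  have o: "orlicz (\<Phi> i)" for i using \<Phi> by (simp add: musielak_orlicz_def)
  have "ennreal (\<Phi> i (SUP n. \<bar>v n i\<bar>)) \<le> (\<Sum>n. ennreal (\<Phi> i (v n i)))" for i
  proof -
    let ?S = "\<Sum>n. ennreal (\<Phi> i (v n i))"
    have "continuous_on UNIV (\<lambda>t. ennreal (\<Phi> i t))"
      using o by (intro continuous_on_ennreal) (simp add: orlicz_def)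
    then have "closed {t. ennreal (\<Phi> i t) \<le> ?S}"
      by (intro closed_Collect_le) auto
    moreover have "range (\<lambda>n. \<bar>v n i\<bar>) \<subseteq> {t. ennreal (\<Phi> i t) \<le> ?S}"
      using sum_le_suminf[of "\<lambda>n. ennreal (\<Phi> i (v n i))" "{n}" for n]
      by (auto simp: orlicz_abs[OF o])
    ultimately show ?thesis
      using closed_subset_contains_Sup[OF _ _ _ bdd] by blast
  qed
  then have "modular \<Phi> (\<lambda>i. SUP n. \<bar>v n i\<bar>)
      \<le> (\<integral>\<^sup>+ i. (\<Sum>n. ennreal (\<Phi> i (v n i))) \<partial>count_space UNIV)"
    unfolding modular_eq_nn_integral by (intro nn_integral_mono)
  also have "\<dots> = (\<Sum>n. modular \<Phi> (v n))"
    unfolding modular_eq_nn_integral by (rule nn_integral_suminf) simp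
  finally show ?thesis .
qed

section \<open>The heart as the closed subspace of sequences with all multiples of finite
  modular\<close>

definition finite_elements :: "(nat \<Rightarrow> real \<Rightarrow> real) \<Rightarrow> (nat \<Rightarrow> real) set" where
  "finite_elements \<Phi> = {x \<in> ell \<Phi>. \<forall>c>0. modular \<Phi> (seq_scale c x) < \<infinity>}"

text \<open>The sum is the midpoint of the doubled sequences, so convexity with weights 1/2
  applies.\<close>

lemma modular_add_finite:
  assumes "musielak_orlicz \<Phi>"
    "modular \<Phi> (seq_scale 2 x) < \<infinity>" "modular \<Phi> (seq_scale 2 y) < \<infinity>"
  shows "modular \<Phi> (x + y) < \<infinity>"
proof -
  have "modular \<Phi> (x + y) \<le> ennreal (1/2) * modular \<Phi> (seq_scale 2 x)
      + ennreal (1/2) * modular \<Phi> (seq_scale 2 y)"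
    using modular_convex[OF assms(1), of "1/2" "1/2" "seq_scale 2 x" "seq_scale 2 y"] by simp
  also have "\<dots> < \<infinity>"
    using assms ennreal_less_top[of "1/2"] by (simp add: ennreal_mult_less_top del: ennreal_half)
  finally show ?thesis .
qed

lemma subspace_finite_elements:
  assumes "musielak_orlicz \<Phi>"
  shows "seqs.subspace (finite_elements \<Phi>)"
proof (rule seqs.subspaceI)
  show "0 \<in> finite_elements \<Phi>"
    using seqs.subspace_0[OF subspace_ell[OF assms]]
    by (simp add: finite_elements_def modular_zero[OF assms])
next
  fix x y assume xy: "x \<in> finite_elements \<Phi>" "y \<in> finite_elements \<Phi>"
  then have "modular \<Phi> (seq_scale c (x + y)) < \<infinity>" if "c > 0" for c
    using that modular_add_finite[OF assms, of "seq_scale c x" "seq_scale c y"]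
    by (simp add: finite_elements_def seqs.scale_right_distrib)
  then show "x + y \<in> finite_elements \<Phi>"
    using xy seqs.subspace_add[OF subspace_ell[OF assms]] by (simp add: finite_elements_def)
next
  fix a x assume x: "x \<in> finite_elements \<Phi>"
  have "modular \<Phi> (seq_scale c (seq_scale a x)) < \<infinity>" if "c > 0" for c
  proof -
    \<comment> \<open>Finiteness is known only for positive multiples; evenness removes the sign of
      \<open>a\<close>, and \<open>a = 0\<close> is treated separately.\<close>
    have "modular \<Phi> (seq_scale (c * a) x) = modular \<Phi> (seq_scale (c * \<bar>a\<bar>) x)"
      using modular_minus[OF assms, of "seq_scale (c * a) x"]
      by (cases "a \<ge> 0") auto
    then show ?thesis
      using x that modular_zero[OF assms] by (cases "a = 0") (auto simp: finite_elements_def)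
  qed
  then show "seq_scale a x \<in> finite_elements \<Phi>"
    using x seqs.subspace_scale[OF subspace_ell[OF assms]] by (simp add: finite_elements_def)
qed

text \<open>The generating set is already a subspace, so the span disappears and the metric
  description of the closure remains.\<close>

lemma mem_h_space_iff:
  assumes "musielak_orlicz \<Phi>" "nondegenerate_seq \<Phi>"
  shows "x \<in> h_space \<Phi> \<longleftrightarrow>
    x \<in> ell \<Phi> \<and> (\<forall>r>0. \<exists>y\<in>finite_elements \<Phi>. lux_norm \<Phi> (x - y) < r)"
proof -
  interpret Metric_space "ell \<Phi>" "lux_dist \<Phi>" by (rule Metric_space_ell[OF assms])
  have "h_space \<Phi> = mtopology closure_of finite_elements \<Phi>"
    unfolding h_space_def ell_topology_def finite_elements_def[symmetric]
    by (subst seqs.span_eq_iff[THEN iffD2, OF subspace_finite_elements[OF assms(1)]]) simp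
  moreover have "y \<in> ell \<Phi>" if "y \<in> finite_elements \<Phi>" for y
    using that by (simp add: finite_elements_def)
  ultimately show ?thesis
    by (auto simp: metric_closure_of lux_dist_def)
qed

text \<open>The finite elements are closed: split \<open>c x\<close> as
  \<open>c (x - y) + c y\<close> with \<open>y\<close> a finite element so near to \<open>x\<close>
  that the first summand is harmless.\<close>

lemma h_space_eq_finite_elements:
  assumes "musielak_orlicz \<Phi>" "nondegenerate_seq \<Phi>"
  shows "h_space \<Phi> = finite_elements \<Phi>"
proof (intro equalityI subsetI)
  fix x assume x: "x \<in> h_space \<Phi>"
  have "modular \<Phi> (seq_scale c x) < \<infinity>" if "c > 0" for c
  proof -
    \<comment> \<open>The radius \<open>1 / (2 * c)\<close> bounds the modular of
      \<open>2 * c\<close> times \<open>x - y\<close> by 1; the factor 2 is the one demanded by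
      \<open>modular_add_finite\<close>.\<close>
    obtain y where y: "y \<in> finite_elements \<Phi>" "lux_norm \<Phi> (x - y) < 1 / (2 * c)"
      using x \<open>c > 0\<close> mem_h_space_iff[OF assms]
      by (metis divide_pos_pos mult_pos_pos zero_less_numeral zero_less_one)
    have "x - y \<in> ell \<Phi>"
      using x y seqs.subspace_diff[OF subspace_ell[OF assms(1)]] mem_h_space_iff[OF assms]
      by (simp add: finite_elements_def)
    from modular_le_1[OF assms(1) this y(2)]
    have "modular \<Phi> (seq_scale 2 (seq_scale c (x - y))) < \<infinity>"
      by (auto intro: le_less_trans)
    moreover have "modular \<Phi> (seq_scale 2 (seq_scale c y)) < \<infinity>"
      using y(1) that by (simp add: finite_elements_def)
    ultimately have "modular \<Phi> (seq_scale c (x - y) + seq_scale c y) < \<infinity>"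
      by (rule modular_add_finite[OF assms(1)])
    then show ?thesis by (simp flip: seqs.scale_right_distrib)
  qed
  then show "x \<in> finite_elements \<Phi>"
    using x mem_h_space_iff[OF assms] by (simp add: finite_elements_def)
next
  fix x assume "x \<in> finite_elements \<Phi>"
  moreover have "lux_norm \<Phi> (x - x) = 0"
    using assms seqs.subspace_0[OF subspace_ell] by (simp add: lux_norm_zero_iff)
  ultimately show "x \<in> h_space \<Phi>"
    unfolding mem_h_space_iff[OF assms] by (auto simp: finite_elements_def)
qed

section \<open>Norm convergence and the strong minimum in terms of the modular\<close>

lemma topspace_ell:
  assumes "musielak_orlicz \<Phi>" "nondegenerate_seq \<Phi>"
  shows "topspace (ell_topology \<Phi>) = ell \<Phi>"
  by (simp add: ell_topology_def Metric_space.topspace_mtopology[OF Metric_space_ell[OF assms]])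

text \<open>The Luxemburg norm is the gauge of the set where the modular is at most 1, so
  \<open>c\<close> plays the part of a reciprocal radius.\<close>

lemma limitin_ell_zero_iff:
  assumes "musielak_orlicz \<Phi>" "nondegenerate_seq \<Phi>" "\<And>n. u n \<in> ell \<Phi>"
  shows "limitin (ell_topology \<Phi>) u 0 sequentially \<longleftrightarrow>
    (\<forall>c>0. \<forall>\<^sub>F n in sequentially. modular \<Phi> (seq_scale c (u n)) \<le> 1)"
proof -
  interpret Metric_space "ell \<Phi>" "lux_dist \<Phi>" by (rule Metric_space_ell[OF assms(1,2)])
  have 0: "0 \<in> ell \<Phi>" by (rule seqs.subspace_0[OF subspace_ell[OF assms(1)]])
  have iff: "limitin (ell_topology \<Phi>) u 0 sequentially \<longleftrightarrow>
      (\<forall>e>0. \<forall>\<^sub>F n in sequentially. lux_norm \<Phi> (u n) < e)"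
    using 0 assms(3) by (simp add: ell_topology_def limitin_metric lux_dist_def)
  show ?thesis
  proof (intro iffI allI impI)
    fix c :: real assume "limitin (ell_topology \<Phi>) u 0 sequentially" "c > 0"
    then have "\<forall>\<^sub>F n in sequentially. lux_norm \<Phi> (u n) < 1 / c"
      using iff by simp
    then show "\<forall>\<^sub>F n in sequentially. modular \<Phi> (seq_scale c (u n)) \<le> 1"
      by eventually_elim (use modular_le_1[OF assms(1,3), of _ "1 / c"] in simp)
  next
    assume *: "\<forall>c>0. \<forall>\<^sub>F n in sequentially. modular \<Phi> (seq_scale c (u n)) \<le> 1"
    show "limitin (ell_topology \<Phi>) u 0 sequentially"
      unfolding iff
    proof (intro allI impI)
      fix e :: real assume e: "e > 0"
      \<comment> \<open>A modular bound yields only a weak norm inequality; aiming at radius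
        \<open>e / 2\<close> makes it strict for \<open>e\<close>.\<close>
      then have "\<forall>\<^sub>F n in sequentially. modular \<Phi> (seq_scale (2 / e) (u n)) \<le> 1"
        using * by simp
      then show "\<forall>\<^sub>F n in sequentially. lux_norm \<Phi> (u n) < e"
        by eventually_elim (use lux_norm_le[of "e / 2" \<Phi>] e in force)
    qed
  qed
qed

text \<open>The infimum of the modular is 0, attained at the zero sequence, so the minimizing
  sequences are those whose modulars tend to 0.\<close>

lemma strong_minimum_modular_iff:
  assumes "musielak_orlicz \<Phi>" "nondegenerate_seq \<Phi>"
  shows "strong_minimum (ell_topology \<Phi>) (modular \<Phi>) 0 \<longleftrightarrow>
    (\<forall>u c. (\<forall>n. u n \<in> ell \<Phi>) \<longrightarrow> (\<lambda>n. modular \<Phi> (u n)) \<longlonglongrightarrow> 0 \<longrightarrow> c > 0 \<longrightarrow>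
       (\<forall>\<^sub>F n in sequentially. modular \<Phi> (seq_scale c (u n)) \<le> 1))"
proof -
  have 0: "0 \<in> ell \<Phi>" by (rule seqs.subspace_0[OF subspace_ell[OF assms(1)]])
  have "(INF x\<in>ell \<Phi>. modular \<Phi> x) \<le> 0"
    using INF_lower[OF 0, of "modular \<Phi>"] by (simp only: modular_zero[OF assms(1)])
  then have "(INF x\<in>ell \<Phi>. modular \<Phi> x) = 0" by simp
  then show ?thesis
    unfolding strong_minimum_def topspace_ell[OF assms]
    using 0 by (auto simp: modular_zero[OF assms(1)] limitin_ell_zero_iff[OF assms])
qed

section \<open>Scaling of sequences with summable modulars\<close>

lemma summable_modular_scale_tendsto_zero:
  assumes \<Phi>: "musielak_orlicz \<Phi>" "nondegenerate_seq \<Phi>"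
    and fin: "\<And>x. x \<in> ell \<Phi> \<Longrightarrow> x \<in> finite_elements \<Phi>"
    and sum: "(\<Sum>n. modular \<Phi> (v n)) < \<infinity>"
    and lim: "(\<lambda>n. modular \<Phi> (v n)) \<longlonglongrightarrow> 0"
    and c: "c > 0"
  shows "(\<lambda>n. modular \<Phi> (seq_scale c (v n))) \<longlonglongrightarrow> 0"
proof -
  have v0: "(\<lambda>n. v n i) \<longlonglongrightarrow> 0" for i
    by (rule modular_tendsto_zero_pointwise[OF \<Phi> lim])
  \<comment> \<open>Coordinatewise convergence bounds each coordinate, so the real supremum below is
    a genuine one.\<close>
  have bdd: "bdd_above (range (\<lambda>n. \<bar>v n i\<bar>))" for i
    using convergent_imp_Bseq[OF convergentI[OF v0[of i]]]
    by (auto simp: Bseq_def intro: bdd_aboveI)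
  define x where "x = (\<lambda>i. SUP n. \<bar>v n i\<bar>)"
  have "modular \<Phi> x < \<infinity>"
    using modular_Sup_abs_le[OF \<Phi>(1) bdd] sum unfolding x_def by (rule le_less_trans)
  then have "x \<in> ell \<Phi>" by (auto simp: ell_def intro!: exI[of _ 1])
  then have "modular \<Phi> (seq_scale c x) < \<infinity>"
    using fin c by (simp add: finite_elements_def)
  then show ?thesis
  proof (rule modular_dominated_tendsto_zero[OF \<Phi>(1)])
    fix n i
    have "\<bar>v n i\<bar> \<le> x i" unfolding x_def by (rule cSUP_upper[OF _ bdd]) simp
    then show "\<bar>seq_scale c (v n) i\<bar> \<le> \<bar>seq_scale c x i\<bar>"
      using c by (simp add: seq_scale_def abs_mult)
    show "(\<lambda>n. seq_scale c (v n) i) \<longlonglongrightarrow> 0" for i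
      unfolding seq_scale_def using tendsto_mult_right_zero[OF v0] .
  qed
qed

text \<open>Since \<open>f\<close> is eventually below \<open>(1/2) ^ k\<close> and \<open>P\<close>
  holds frequently, some index satisfies both; the geometric series then dominates. The chosen
  indices \<open>s k\<close> are not claimed to increase.\<close>

lemma frequently_small_subsequence:
  fixes f :: "nat \<Rightarrow> ennreal"
  assumes "f \<longlonglongrightarrow> 0" "\<exists>\<^sub>F n in sequentially. P n"
  obtains s where "\<And>k::nat. P (s k)" "(\<Sum>k. f (s k)) < \<infinity>" "(\<lambda>k. f (s k)) \<longlonglongrightarrow> 0"
proof -
  have "\<exists>n. P n \<and> f n \<le> ennreal ((1/2) ^ k)" for k :: nat
  proof -
    have "\<forall>\<^sub>F n in sequentially. f n < ennreal ((1/2) ^ k)"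
      using assms(1) by (rule order_tendstoD) simp
    with assms(2) have "\<exists>\<^sub>F n in sequentially. P n \<and> f n < ennreal ((1/2) ^ k)"
      by (rule frequently_eventually_conj[THEN frequently_mono[rotated]]) auto
    then show ?thesis by (auto dest!: frequently_ex intro: less_imp_le)
  qed
  then obtain s where s: "\<And>k. P (s k)" "\<And>k. f (s k) \<le> ennreal ((1/2) ^ k)" by metis
  have lim: "(\<lambda>k. ennreal ((1/2) ^ k)) \<longlonglongrightarrow> 0"
    using tendsto_ennrealI[OF LIMSEQ_power_zero[of "1/2::real"]] by simp
  have "(\<Sum>k. f (s k)) \<le> (\<Sum>k. ennreal ((1/2) ^ k))"
    by (intro suminf_le s) auto
  also have "\<dots> = ennreal (\<Sum>k. (1/2) ^ k)"
    by (rule suminf_ennreal2) (auto intro: summable_geometric)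
  also have "\<dots> < \<infinity>" by simp
  finally have "(\<Sum>k. f (s k)) < \<infinity>" .
  moreover have "(\<lambda>k. f (s k)) \<longlonglongrightarrow> 0"
    by (rule tendsto_sandwich[OF _ _ tendsto_const lim]) (use s in auto)
  ultimately show thesis using s that by blast
qed

section \<open>Truncations and tails\<close>

lemma finitely_supported_in_finite_elements:
  assumes "musielak_orlicz \<Phi>" "\<And>i. i \<ge> n \<Longrightarrow> x i = 0"
  shows "x \<in> finite_elements \<Phi>"
proof -
  have "modular \<Phi> (seq_scale c x) < \<infinity>" for c
  proof -
    have "modular \<Phi> (seq_scale c x) = (\<Sum>i<n. ennreal (\<Phi> i (c * x i)))"
      unfolding modular_def seq_scale_def using assms
      by (intro suminf_finite) (auto simp: musielak_orlicz_def orlicz_def)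
    then show ?thesis by simp
  qed
  then show ?thesis by (auto simp: finite_elements_def ell_def intro!: exI[of _ 1])
qed

text \<open>The tails are dominated by \<open>x\<close> itself, and coordinate \<open>i\<close>
  vanishes as soon as \<open>n > i\<close>.\<close>

lemma modular_tail_tendsto_zero:
  assumes "musielak_orlicz \<Phi>" "modular \<Phi> x < \<infinity>"
  shows "(\<lambda>n. modular \<Phi> (\<lambda>i. if i < n then 0 else x i)) \<longlonglongrightarrow> 0"
  using assms
proof (rule modular_dominated_tendsto_zero)
  show "(\<lambda>n. if i < n then 0 else x i) \<longlonglongrightarrow> 0" for i
    by (rule tendsto_eventually, rule eventually_mono[OF eventually_gt_at_top[of i]]) simp
qed auto

theorem lemma8:
  fixes \<Phi> :: "nat \<Rightarrow> real \<Rightarrow> real"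
  assumes "musielak_orlicz \<Phi>" and "nondegenerate_seq \<Phi>"
  shows "h_space \<Phi> = ell \<Phi> \<longleftrightarrow> strong_minimum (ell_topology \<Phi>) (modular \<Phi>) 0"
proof
  assume "h_space \<Phi> = ell \<Phi>"
  then have fin: "x \<in> finite_elements \<Phi>" if "x \<in> ell \<Phi>" for x
    using that h_space_eq_finite_elements[OF assms] by simp
  show "strong_minimum (ell_topology \<Phi>) (modular \<Phi>) 0"
    unfolding strong_minimum_modular_iff[OF assms]
  proof (intro allI impI, rule ccontr)
    fix u c assume u: "(\<lambda>n. modular \<Phi> (u n)) \<longlonglongrightarrow> 0" and c: "(c::real) > 0"
      and "\<not> (\<forall>\<^sub>F n in sequentially. modular \<Phi> (seq_scale c (u n)) \<le> 1)"
    \<comment> \<open>The negated bound holds infinitely often, so offending terms can be selected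
      with summable modulars.\<close>
    then have "\<exists>\<^sub>F n in sequentially. \<not> modular \<Phi> (seq_scale c (u n)) \<le> 1"
      by (simp add: frequently_def)
    from frequently_small_subsequence[OF u this] obtain s where
      s: "\<And>k. \<not> modular \<Phi> (seq_scale c (u (s k))) \<le> 1"
        "(\<Sum>k. modular \<Phi> (u (s k))) < \<infinity>" "(\<lambda>k. modular \<Phi> (u (s k))) \<longlonglongrightarrow> 0"
      by metis
    have "(\<lambda>k. modular \<Phi> (seq_scale c (u (s k)))) \<longlonglongrightarrow> 0"
      by (rule summable_modular_scale_tendsto_zero[OF assms fin s(2,3) c])
    then have "\<forall>\<^sub>F k in sequentially. modular \<Phi> (seq_scale c (u (s k))) < 1"
      by (rule order_tendstoD) simp
    then obtain k where "modular \<Phi> (seq_scale c (u (s k))) < 1"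
      by (auto dest: eventually_happens)
    with s(1) show False by (meson less_imp_le)
  qed
next
  assume "strong_minimum (ell_topology \<Phi>) (modular \<Phi>) 0"
  then have min: "\<forall>\<^sub>F n in sequentially. modular \<Phi> (seq_scale c (u n)) \<le> 1"
    if "\<And>n. u n \<in> ell \<Phi>" "(\<lambda>n. modular \<Phi> (u n)) \<longlonglongrightarrow> 0" "c > 0" for u and c :: real
    using that unfolding strong_minimum_modular_iff[OF assms] by blast
  have "x \<in> h_space \<Phi>" if x: "x \<in> ell \<Phi>" for x
    unfolding mem_h_space_iff[OF assms]
  proof (intro conjI x allI impI)
    fix r :: real assume r: "r > 0"
    obtain c where c: "c > 0" "modular \<Phi> (seq_scale c x) < \<infinity>"
      using x by (auto simp: ell_def)
    \<comment> \<open>The tail \<open>t n\<close> measures the error when \<open>x\<close> is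
      approximated by its truncation \<open>x - t n\<close>.\<close>
    define t where "t = (\<lambda>n i. if i < n then 0 else x i)"
    have fin: "x - t n \<in> finite_elements \<Phi>" for n
      by (rule finitely_supported_in_finite_elements[OF assms(1), of n]) (simp add: t_def)
    then have t_ell: "t n \<in> ell \<Phi>" for n
      using seqs.subspace_diff[OF subspace_ell[OF assms(1)] x, of "x - t n"]
      by (simp add: finite_elements_def)
    have "seq_scale c (t n) = (\<lambda>i. if i < n then 0 else seq_scale c x i)" for n
      by (auto simp: t_def seq_scale_def)
    then have "(\<lambda>n. modular \<Phi> (seq_scale c (t n))) \<longlonglongrightarrow> 0"
      using modular_tail_tendsto_zero[OF assms(1) c(2)] by simp
    moreover have "seq_scale c (t n) \<in> ell \<Phi>" for n
      using seqs.subspace_scale[OF subspace_ell[OF assms(1)] t_ell] .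
    \<comment> \<open>The factor \<open>2 / (r * c)\<close> cancels \<open>c\<close> and leaves
      \<open>2 / r\<close> times \<open>t n\<close>, which is the bound needed for norm at most
      \<open>r / 2\<close>.\<close>
    ultimately have "\<forall>\<^sub>F n in sequentially.
        modular \<Phi> (seq_scale (2 / (r * c)) (seq_scale c (t n))) \<le> 1"
      using r c by (intro min) auto
    then obtain n where "modular \<Phi> (seq_scale (2 / (r * c)) (seq_scale c (t n))) \<le> 1"
      by (auto dest: eventually_happens)
    then have "lux_norm \<Phi> (t n) \<le> r / 2"
      using r c by (intro lux_norm_le) auto
    then have "lux_norm \<Phi> (x - (x - t n)) < r" using r by simp
    with fin show "\<exists>y\<in>finite_elements \<Phi>. lux_norm \<Phi> (x - y) < r" by blast
  qed
  then show "h_space \<Phi> = ell \<Phi>"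
    using mem_h_space_iff[OF assms] by blast
qed

end
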